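(* Let $d\ge 1$. There exists a constant $c(d)>0$ depending only on $d$ such that, for all real numbers $n_1,\dots,n_d\ge 1$ and every bounded convex polyhedron $P$ in $\mathbb{R}^d$ with $[0,n_1]\times\dots\times[0,n_d]\subset P\subset\mathbb{R}_+^d$, $$c(d)\prod_{j=1}^d\log(n_j+1)\le\mathcal{L}(P).$$
   Context: $\mathbb{R}_+^d$ is the set of vectors in $\mathbb{R}^d$ with nonnegative coordinates. For a bounded set $W\subset\mathbb{R}^d$ the Lebesgue constant is $$\mathcal{L}(W)=\frac{1}{(2\pi)^d}\int_{\mathbb{T}^d}\bigg|\sum_{\bm{k}\in W\cap\mathbb{Z}^d}e^{i(\bm{k},\bm{x})}\bigg|\,d\bm{x},\qquad \mathbb{T}^d\simeq(-\pi,\pi]^d,$$ where $(\bm{k},\bm{x})=k_1x_1+\dots+k_dx_d$. *)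

theory Defs
  imports "HOL-Analysis.Analysis"
begin

text \<open>Fundamental domain $(-\pi,\pi]^d$ of the torus.\<close>

definition torus :: "(real ^ 'd) set" where
  "torus = {x. \<forall>j. - pi < x $ j \<and> x $ j \<le> pi}"

definition lattice_points :: "(real ^ 'd) set \<Rightarrow> (real ^ 'd) set" where
  "lattice_points W = {k \<in> W. \<forall>j. k $ j \<in> \<int>}"

text \<open>Only meaningful for bounded \<open>W\<close>: then \<open>lattice_points W\<close> is finite and the
  integrand is bounded and continuous, so neither the sum nor the integral takes a default value.\<close>

definition lebesgue_constant :: "(real ^ 'd) set \<Rightarrow> real" where
  "lebesgue_constant W =
     1 / (2 * pi) ^ CARD('d) *
       (LINT x:torus|lborel.
          cmod (\<Sum>k\<in>lattice_points W. exp (\<i> * complex_of_real (k \<bullet> x))))"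

end

theory Submission
  imports Defs
begin

text \<open>
  The lower bound is a case of Hardy's inequality \<open>\<Sum>k\<ge>0. \<bar>a\<^sub>k\<bar> / (k + 1) \<le> \<pi> \<parallel>f\<parallel>\<^sub>1\<close> for
  functions \<open>f\<close> whose Fourier spectrum is nonnegative, in its version on the \<open>d\<close>-dimensional torus.
  All nonzero Fourier coefficients of the Dirichlet kernel of \<open>P\<close> are \<open>1\<close>, so only the elementary half of
  Hardy's inequality is involved, which is a duality argument. A shifted sawtooth \<open>g\<close> on
  \<open>(-\<pi>, \<pi>]\<close> is bounded by \<open>\<pi>\<close> and pairs with \<open>exp (\<i> k t)\<close> to \<open>2 \<pi> / (k + 1)\<close> for every integer
  \<open>k \<ge> 0\<close> (lemma \<open>has_bochner_integral_hardy_kernel\<close>). Integrating a trigonometric polynomial with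
  nonnegative spectrum against \<open>\<Prod>j. g (x\<^sub>j)\<close> therefore weights its coefficients by
  \<open>\<Prod>j. 2 \<pi> / (k\<^sub>j + 1)\<close>, while the integral is at most \<open>\<pi>\<^sup>d\<close> times the \<open>L\<^sup>1\<close> norm
  (lemma \<open>hardy_inequality_torus\<close>).

  For the Dirichlet kernel of \<open>P\<close> all terms of the weighted sum are positive. Those that come from the
  box \<open>[0, n\<^sub>1] \<times> \<dots> \<times> [0, n\<^sub>d]\<close> alone add up to a product of harmonic numbers, hence to at least
  \<open>\<Prod>j. log (n\<^sub>j + 1)\<close>. This gives the theorem with \<open>c(d) = \<pi>\<^sup>-\<^sup>d\<close>.
\<close>

section \<open>A bounded function with Fourier coefficients \<open>1 / (k + 1)\<close>\<close>

text \<open>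
  The sawtooth \<open>sgn t * pi - t\<close> has Fourier series \<open>2 * (\<Sum>m\<ge>1. sin (m * t) / m)\<close>. The factor
  \<open>exp (\<i> * t)\<close> shifts the frequencies by one, so that the singular index \<open>m = 0\<close> is moved to \<open>k = - 1\<close>.
\<close>

definition hardy_kernel :: "real \<Rightarrow> complex" where
  "hardy_kernel t = - \<i> * complex_of_real (sgn t * pi - t) * exp (\<i> * complex_of_real t)"

lemma norm_hardy_kernel_le:
  assumes "- pi < t" "t \<le> pi"
  shows "cmod (hardy_kernel t) \<le> pi"
proof -
  have "cmod (hardy_kernel t) = \<bar>sgn t * pi - t\<bar>"
    unfolding hardy_kernel_def norm_mult by (simp del: of_real_diff of_real_mult)
  also have "\<dots> \<le> pi"
    using assms pi_gt_zero by (cases t "0::real" rule: linorder_cases) auto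
  finally show ?thesis .
qed

text \<open>
  One antiderivative serves both halves of the sawtooth; the constants \<open>c = pi\<close> and \<open>c = - pi\<close> belong
  to \<open>t > 0\<close> and \<open>t < 0\<close>.
\<close>

lemma has_bochner_integral_linear_exp:
  fixes a b c m :: real
  assumes "a \<le> b" "m \<noteq> 0"
  defines "F \<equiv> \<lambda>t. (complex_of_real (c - t) / (\<i> * of_real m) + 1 / (\<i> * of_real m)^2)
                    * exp (\<i> * of_real m * of_real t)"
  shows "has_bochner_integral lborel
           (\<lambda>t. indicator {a..b} t *\<^sub>R (complex_of_real (c - t) * exp (\<i> * of_real m * of_real t)))
           (F b - F a)"
proof (rule has_bochner_integral_FTC_Icc[OF assms(1)])
  fix t assume "a \<le> t" "t \<le> b"
  define G where "G z = ((of_real c - z) / (\<i> * of_real m) + 1 / (\<i> * of_real m)^2)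
                    * exp (\<i> * of_real m * z)" for z :: complex
  have "(G has_field_derivative (complex_of_real (c - t) * exp (\<i> * of_real m * of_real t))) (at (of_real t))"
    unfolding G_def using assms(2)
    by (auto intro!: derivative_eq_intros simp: field_simps power2_eq_square)
  from has_vector_derivative_real_field[OF this]
  show "(F has_vector_derivative (complex_of_real (c - t) * exp (\<i> * of_real m * of_real t))) (at t within {a..b})"
    by (simp add: F_def G_def)
next
  show "continuous_on {a..b} (\<lambda>t. complex_of_real (c - t) * exp (\<i> * of_real m * of_real t))"
    by (intro continuous_intros)
qed

lemma has_bochner_integral_hardy_kernel:
  fixes k :: real
  assumes "k \<in> \<int>" "0 \<le> k"
  shows "has_bochner_integral lborel
           (\<lambda>t. indicator {- pi<..pi} t *\<^sub>R (exp (\<i> * complex_of_real (k * t)) * hardy_kernel t))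
           (complex_of_real (2 * pi / (k + 1)))"
proof -
  define m where "m = k + 1"
  have m: "m > 0" "m \<in> \<int>" using assms by (auto simp: m_def)
  define f where "f c t = complex_of_real (c - t) * exp (\<i> * of_real m * of_real t)" for c t
  define F where "F c t = (complex_of_real (c - t) / (\<i> * of_real m) + 1 / (\<i> * of_real m)^2)
                    * exp (\<i> * of_real m * of_real t)" for c t
  have "has_bochner_integral lborel (\<lambda>t. indicator {a..b} t *\<^sub>R f c t) (F c b - F c a)"
    if "a \<le> b" for a b c
    unfolding f_def F_def by (rule has_bochner_integral_linear_exp) (use that m in auto)
  from has_bochner_integral_add[OF this this]
  have "has_bochner_integral lborel
          (\<lambda>t. indicator {0..pi} t *\<^sub>R f pi t + indicator {- pi..0} t *\<^sub>R f (- pi) t)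
          ((F pi pi - F pi 0) + (F (- pi) 0 - F (- pi) (- pi)))" (is "has_bochner_integral _ ?f ?I")
    by simp
  then have "has_bochner_integral lborel (\<lambda>t. - \<i> * ?f t) (- \<i> * ?I)"
    by (rule has_bochner_integral_mult_right)
  also have "(\<lambda>t. - \<i> * ?f t) =
      (\<lambda>t. indicator {- pi<..pi} t *\<^sub>R (exp (\<i> * complex_of_real (k * t)) * hardy_kernel t))"
  proof
    fix t
    have e: "exp (\<i> * complex_of_real (k * t)) * exp (\<i> * complex_of_real t)
             = exp (\<i> * of_real m * of_real t)"
      by (simp add: m_def exp_add[symmetric] algebra_simps)
    have h: "exp (\<i> * complex_of_real (k * t)) * hardy_kernel t = - \<i> * f (sgn t * pi) t"
      unfolding f_def e[symmetric] hardy_kernel_def by simp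
    \<comment> \<open>At \<open>t = 0\<close> both halves count and cancel, and at \<open>t = - pi\<close> the left half vanishes:
        the identity has no exceptional points.\<close>
    show "- \<i> * ?f t = indicator {- pi<..pi} t *\<^sub>R (exp (\<i> * complex_of_real (k * t)) * hardy_kernel t)"
      unfolding h
      by (cases t "0::real" rule: linorder_cases; cases "t = - pi")
         (auto simp: f_def indicator_def not_le[THEN iffD2, OF pi_gt_zero])
  qed
  also have "- \<i> * ?I = complex_of_real (2 * pi / (k + 1))"
  proof -
    obtain j :: int where j: "m = of_int j" using m(2) by (auto elim: Ints_cases)
    \<comment> \<open>Since \<open>m\<close> is an integer, the exponential terms at \<open>pi\<close> and \<open>- pi\<close> agree, and only the
        jump of the sawtooth at \<open>0\<close> contributes.\<close>
    have "exp (\<i> * of_real m * of_real pi) = exp (\<i> * of_real m * of_real (- pi))"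
      unfolding exp_eq by (rule exI[of _ j]) (simp add: j)
    then have I: "?I = - 2 * of_real pi / (\<i> * of_real m)"
      using m by (simp add: F_def field_simps power2_eq_square)
    show ?thesis
      unfolding I m_def[symmetric] by (simp add: field_simps)
  qed
  finally show ?thesis .
qed

section \<open>Hardy's inequality on the torus\<close>

lemma has_bochner_integral_lborel_prod_Basis:
  fixes f :: "'a::euclidean_space \<Rightarrow> real \<Rightarrow> 'b::{real_normed_field, banach, second_countable_topology}"
  assumes "\<And>b. b \<in> Basis \<Longrightarrow> has_bochner_integral lborel (f b) (I b)"
  shows "has_bochner_integral lborel (\<lambda>x. \<Prod>b\<in>Basis. f b (x \<bullet> b)) (\<Prod>b\<in>Basis. I b)"
proof -
  let ?L = "\<lambda>_::'a. interval_measure (\<lambda>x. x)"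
  interpret product_sigma_finite ?L
    by (intro product_sigma_finite.intro sigma_finite_interval_measure) auto
  have f: "integrable (?L b) (f b)" "integral\<^sup>L (?L b) (f b) = I b" if "b \<in> Basis" for b
    using assms[OF that] by (auto simp: has_bochner_integral_iff lborel_eq_real)
  have "has_bochner_integral (Pi\<^sub>M Basis ?L) (\<lambda>x. \<Prod>b\<in>Basis. f b (x b)) (\<Prod>b\<in>Basis. I b)"
    using product_integrable_prod[of Basis f] product_integral_prod[of Basis f] f
    by (simp add: has_bochner_integral_iff)
  also have "(\<lambda>x. \<Prod>b\<in>Basis. f b (x b)) = (\<lambda>x. \<Prod>b\<in>Basis. f b ((\<Sum>b\<in>Basis. x b *\<^sub>R b) \<bullet> b))"
    by (intro ext prod.cong) auto
  finally have *: "has_bochner_integral (Pi\<^sub>M Basis ?L)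
      (\<lambda>x. \<Prod>b\<in>Basis. f b ((\<Sum>b\<in>Basis. x b *\<^sub>R b) \<bullet> b)) (\<Prod>b\<in>Basis. I b)" .
  have [measurable]: "f b \<in> borel_measurable borel" if "b \<in> Basis" for b
    using assms[OF that] by (auto simp: has_bochner_integral_iff dest: borel_measurable_integrable)
  show ?thesis
    unfolding lborel_def
    by (rule has_bochner_integral_distr[where f = "\<lambda>x. \<Prod>b\<in>Basis. f b (x \<bullet> b)", OF _ _ *]) measurable
qed

lemma prod_Basis_vec:
  fixes g :: "real ^ 'd \<Rightarrow> 'b::comm_monoid_mult"
  shows "(\<Prod>b\<in>Basis. g b) = (\<Prod>j\<in>UNIV. g (axis j 1))"
proof -
  have "Basis = range (\<lambda>j. axis j 1 :: real ^ 'd)"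
    by (auto simp: Basis_vec_def)
  show ?thesis
    unfolding \<open>Basis = _\<close> by (subst prod.reindex) (auto simp: inj_on_def axis_eq_axis)
qed

lemma has_bochner_integral_torus_hardy_kernel:
  fixes k :: "real ^ 'd"
  assumes "\<And>j. k $ j \<in> \<int>" "\<And>j. 0 \<le> k $ j"
  shows "has_bochner_integral lborel
           (\<lambda>x. indicator torus x *\<^sub>R (exp (\<i> * complex_of_real (k \<bullet> x)) * (\<Prod>j\<in>UNIV. hardy_kernel (x $ j))))
           (complex_of_real (\<Prod>j\<in>UNIV. 2 * pi / (k $ j + 1)))"
proof -
  define \<phi> where "\<phi> b t = indicator {- pi<..pi} t *\<^sub>R (exp (\<i> * complex_of_real ((k \<bullet> b) * t)) * hardy_kernel t)"
    for b :: "real ^ 'd" and t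
  have "has_bochner_integral lborel (\<lambda>x. \<Prod>b\<in>Basis. \<phi> b (x \<bullet> b))
          (\<Prod>b\<in>Basis. complex_of_real (2 * pi / (k \<bullet> b + 1)))"
    unfolding \<phi>_def
    by (intro has_bochner_integral_lborel_prod_Basis has_bochner_integral_hardy_kernel)
       (auto simp: Basis_vec_def inner_axis assms)
  also have "(\<lambda>x. \<Prod>b\<in>Basis. \<phi> b (x \<bullet> b)) =
    (\<lambda>x. indicator torus x *\<^sub>R (exp (\<i> * complex_of_real (k \<bullet> x)) * (\<Prod>j\<in>UNIV. hardy_kernel (x $ j))))"
  proof
    fix x :: "real ^ 'd"
    have i: "(\<Prod>j\<in>UNIV. indicator {- pi<..pi} (x $ j)) = (indicator torus x :: complex)"
      by (auto simp: torus_def indicator_def)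
    have e: "(\<Prod>j\<in>UNIV. exp (\<i> * complex_of_real (k $ j * x $ j))) = exp (\<i> * complex_of_real (k \<bullet> x))"
      by (simp add: exp_sum[symmetric] inner_vec_def sum_distrib_left)
    have "(\<Prod>b\<in>Basis. \<phi> b (x \<bullet> b)) = (\<Prod>j\<in>UNIV. indicator {- pi<..pi} (x $ j) *
            (exp (\<i> * complex_of_real (k $ j * x $ j)) * hardy_kernel (x $ j)))"
      unfolding prod_Basis_vec \<phi>_def
      by (intro prod.cong) (auto simp: inner_axis indicator_def)
    also have "\<dots> = indicator torus x * (exp (\<i> * complex_of_real (k \<bullet> x)) * (\<Prod>j\<in>UNIV. hardy_kernel (x $ j)))"
      unfolding prod.distrib i e ..
    finally show "(\<Prod>b\<in>Basis. \<phi> b (x \<bullet> b)) = indicator torus x *\<^sub>R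
        (exp (\<i> * complex_of_real (k \<bullet> x)) * (\<Prod>j\<in>UNIV. hardy_kernel (x $ j)))"
      by (simp add: indicator_def)
  qed
  also have "(\<Prod>b\<in>Basis. complex_of_real (2 * pi / (k \<bullet> b + 1))) = complex_of_real (\<Prod>j\<in>UNIV. 2 * pi / (k $ j + 1))"
    by (simp add: prod_Basis_vec inner_axis)
  finally show ?thesis .
qed

lemma torus_measurable [measurable]: "(torus :: (real ^ 'd) set) \<in> sets borel"
proof -
  have "torus = (\<Inter>j. {x :: real ^ 'd. - pi < x $ j} \<inter> {x. x $ j \<le> pi})"
    by (auto simp: torus_def)
  also have "\<dots> \<in> sets borel"
    by (intro sets.finite_INT sets.Int borel_open borel_closed open_Collect_less closed_Collect_le continuous_intros)
       auto
  finally show ?thesis .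
qed

lemma continuous_imp_set_integrable_torus:
  fixes f :: "real ^ 'd \<Rightarrow> 'b::{banach, second_countable_topology}"
  assumes "continuous_on UNIV f"
  shows "set_integrable lborel torus f"
proof (rule set_integrable_subset)
  show "set_integrable lborel (cbox (\<chi> j. - pi) (\<chi> j. pi)) f"
    unfolding set_integrable_def
    by (intro borel_integrable_compact compact_cbox continuous_on_subset[OF assms]) auto
  show "torus \<subseteq> cbox (\<chi> j. - pi) (\<chi> j. pi)"
    by (auto simp: torus_def mem_box_cart less_imp_le)
qed simp

text \<open>
  The absolute values stand outside the weighted sum of coefficients, so this is the elementary half of
  Hardy's inequality: it compares the integral of \<open>f\<close> against the bounded product kernel with
  the \<open>L\<^sup>1\<close> norm of \<open>f\<close>.
\<close>

lemma hardy_inequality_torus: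
  fixes K :: "(real ^ 'd) set" and a :: "real ^ 'd \<Rightarrow> complex"
  assumes K: "finite K" "\<And>k j. k \<in> K \<Longrightarrow> k $ j \<in> \<int>" "\<And>k j. k \<in> K \<Longrightarrow> 0 \<le> k $ j"
  shows "cmod (\<Sum>k\<in>K. a k * of_real (\<Prod>j\<in>UNIV. 2 * pi / (k $ j + 1)))
           \<le> pi ^ CARD('d) * (LINT x:torus|lborel. cmod (\<Sum>k\<in>K. a k * exp (\<i> * complex_of_real (k \<bullet> x))))"
proof -
  define f where "f x = (\<Sum>k\<in>K. a k * exp (\<i> * complex_of_real (k \<bullet> x)))" for x
  define g :: "real ^ 'd \<Rightarrow> complex" where "g x = (\<Prod>j\<in>UNIV. hardy_kernel (x $ j))" for x
  have "has_bochner_integral lborel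
          (\<lambda>x. \<Sum>k\<in>K. a k * (indicator torus x *\<^sub>R (exp (\<i> * complex_of_real (k \<bullet> x)) * g x)))
          (\<Sum>k\<in>K. a k * of_real (\<Prod>j\<in>UNIV. 2 * pi / (k $ j + 1)))"
    unfolding g_def
    by (intro has_bochner_integral_sum has_bochner_integral_mult_right
          has_bochner_integral_torus_hardy_kernel K)
  also have "(\<lambda>x. \<Sum>k\<in>K. a k * (indicator torus x *\<^sub>R (exp (\<i> * complex_of_real (k \<bullet> x)) * g x)))
      = (\<lambda>x. indicator torus x *\<^sub>R (f x * g x))"
    by (auto simp: f_def indicator_def sum_distrib_right mult.assoc)
  finally have fg: "has_bochner_integral lborel (\<lambda>x. indicator torus x *\<^sub>R (f x * g x))
          (\<Sum>k\<in>K. a k * of_real (\<Prod>j\<in>UNIV. 2 * pi / (k $ j + 1)))" .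
  have g: "cmod (g x) \<le> pi ^ CARD('d)" if "x \<in> torus" for x
  proof -
    have "cmod (g x) = (\<Prod>j\<in>UNIV. cmod (hardy_kernel (x $ j)))"
      by (simp add: g_def prod_norm)
    also have "\<dots> \<le> (\<Prod>j\<in>(UNIV :: 'd set). pi)"
      using that by (intro prod_mono) (auto simp: torus_def norm_hardy_kernel_le)
    finally show ?thesis by simp
  qed
  have f: "set_integrable lborel torus (\<lambda>x. cmod (f x))"
    unfolding f_def by (intro continuous_imp_set_integrable_torus continuous_intros)
  have "cmod (\<Sum>k\<in>K. a k * of_real (\<Prod>j\<in>UNIV. 2 * pi / (k $ j + 1)))
      = cmod (LINT x|lborel. indicator torus x *\<^sub>R (f x * g x))"
    using has_bochner_integral_integral_eq[OF fg] by simp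
  also have "\<dots> \<le> (LINT x|lborel. pi ^ CARD('d) * (indicator torus x *\<^sub>R cmod (f x)))"
  proof (rule Bochner_Integration.integral_norm_bound_integral)
    show "integrable lborel (\<lambda>x. indicator torus x *\<^sub>R (f x * g x))"
      using fg by (rule integrable.intros)
    show "integrable lborel (\<lambda>x. pi ^ CARD('d) * (indicator torus x *\<^sub>R cmod (f x)))"
      using f by (simp add: set_integrable_def)
    show "cmod (indicator torus x *\<^sub>R (f x * g x)) \<le> pi ^ CARD('d) * (indicator torus x *\<^sub>R cmod (f x))" for x
      using g[of x] by (auto simp: indicator_def norm_mult mult.commute[of _ "cmod (f x)"] intro: mult_left_mono)
  qed
  also have "\<dots> = pi ^ CARD('d) * (LINT x:torus|lborel. cmod (f x))"
    by (simp add: set_lebesgue_integral_def)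
  finally show ?thesis by (simp add: f_def)
qed

section \<open>Lebesgue constants of sets in the nonnegative orthant\<close>

lemma finite_vec_components:
  fixes A :: "'d::finite \<Rightarrow> 'a set"
  assumes "\<And>j. finite (A j)"
  shows "finite {x :: 'a ^ 'd. \<forall>j. x $ j \<in> A j}"
proof (rule finite_subset)
  show "{x :: 'a ^ 'd. \<forall>j. x $ j \<in> A j} \<subseteq> vec_lambda ` PiE UNIV A"
    by (force simp: image_iff vec_eq_iff intro: bexI[of _ "vec_nth _"])
  show "finite (vec_lambda ` PiE UNIV A)"
    using assms by (intro finite_imageI finite_PiE) auto
qed

lemma finite_lattice_points:
  fixes W :: "(real ^ 'd) set"
  assumes "bounded W"
  shows "finite (lattice_points W)"
proof -
  obtain B where B: "\<And>x. x \<in> W \<Longrightarrow> norm x \<le> B"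
    using assms by (auto simp: bounded_iff)
  have "lattice_points W \<subseteq> {x. \<forall>j. x $ j \<in> {t \<in> \<int>. \<bar>t\<bar> \<le> B}}"
    using B component_le_norm_cart order_trans by (fastforce simp: lattice_points_def)
  then show ?thesis
    by (rule finite_subset) (intro finite_vec_components finite_abs_int_segment)
qed

lemma hardy_lebesgue_constant:
  fixes W :: "(real ^ 'd) set"
  assumes "bounded W" "W \<subseteq> {x. \<forall>j. 0 \<le> x $ j}"
  shows "(\<Sum>k\<in>lattice_points W. \<Prod>j\<in>UNIV. 1 / (k $ j + 1)) \<le> pi ^ CARD('d) * lebesgue_constant W"
proof -
  let ?K = "lattice_points W"
  let ?S = "\<Sum>k\<in>?K. \<Prod>j\<in>UNIV. 1 / (k $ j + 1)"
  have K: "0 \<le> k $ j" "k $ j \<in> \<int>" if "k \<in> ?K" for k j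
    using that assms(2) by (auto simp: lattice_points_def)
  have "(\<Prod>j\<in>UNIV. 2 * pi / (k $ j + 1)) = (2 * pi) ^ CARD('d) * (\<Prod>j\<in>UNIV. 1 / (k $ j + 1))" for k :: "real ^ 'd"
    by (simp add: prod_dividef)
  then have "(2 * pi) ^ CARD('d) * ?S = (\<Sum>k\<in>?K. \<Prod>j\<in>UNIV. 2 * pi / (k $ j + 1))"
    by (simp add: sum_distrib_left)
  also have "\<dots> \<le> cmod (\<Sum>k\<in>?K. 1 * of_real (\<Prod>j\<in>UNIV. 2 * pi / (k $ j + 1)))"
    by (simp only: mult_1_left of_real_sum[symmetric] norm_of_real abs_ge_self)
  also have "\<dots> \<le> pi ^ CARD('d) * (LINT x:torus|lborel. cmod (\<Sum>k\<in>?K. 1 * exp (\<i> * complex_of_real (k \<bullet> x))))"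
    using K finite_lattice_points[OF assms(1)] by (intro hardy_inequality_torus) auto
  finally show ?thesis
    by (simp add: lebesgue_constant_def field_simps)
qed

lemma ln_le_sum_reciprocals:
  fixes y :: real
  assumes "0 \<le> y"
  shows "ln (y + 1) \<le> (\<Sum>t | t \<in> \<int> \<and> 0 \<le> t \<and> t \<le> y. 1 / (t + 1))"
proof -
  define N where "N = nat \<lfloor>y\<rfloor>"
  have N: "real N \<le> y" "y < real N + 1" using assms by (auto simp: N_def)
  have "ln (y + 1) \<le> ln (real (Suc N) + 1)"
    using N assms by simp
  also have "\<dots> \<le> harm (Suc N)"
    by (rule ln_le_harm)
  also have "\<dots> = (\<Sum>i\<le>N. 1 / (real i + 1))"
    unfolding harm_def by (rule sum.reindex_bij_witness[of _ Suc "\<lambda>i. i - 1"]) (auto simp: field_simps)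
  also have "\<dots> = (\<Sum>t\<in>real ` {..N}. 1 / (t + 1))"
    by (simp add: sum.reindex)
  also have "\<dots> \<le> (\<Sum>t | t \<in> \<int> \<and> 0 \<le> t \<and> t \<le> y. 1 / (t + 1))"
    using N by (intro sum_mono2 finite_int_segment) auto
  finally show ?thesis .
qed

lemma prod_ln_le_sum_lattice_points:
  fixes W :: "(real ^ 'd) set" and n :: "real ^ 'd"
  assumes "bounded W" "W \<subseteq> {x. \<forall>j. 0 \<le> x $ j}" "{x. \<forall>j. 0 \<le> x $ j \<and> x $ j \<le> n $ j} \<subseteq> W"
    and "\<And>j. 0 \<le> n $ j"
  shows "(\<Prod>j\<in>UNIV. ln (n $ j + 1)) \<le> (\<Sum>k\<in>lattice_points W. \<Prod>j\<in>UNIV. 1 / (k $ j + 1))"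
proof -
  define B where "B j = {t \<in> \<int>. 0 \<le> t \<and> t \<le> n $ j}" for j
  have "(\<Prod>j\<in>UNIV. ln (n $ j + 1)) \<le> (\<Prod>j\<in>UNIV. \<Sum>t\<in>B j. 1 / (t + 1))"
    unfolding B_def using assms(4) by (intro prod_mono conjI ln_le_sum_reciprocals) auto
  also have "\<dots> = (\<Sum>h\<in>PiE UNIV B. \<Prod>j\<in>UNIV. 1 / (h j + 1))"
    by (intro prod_sum_PiE) (auto simp: B_def finite_int_segment)
  also have "\<dots> = (\<Sum>k\<in>vec_lambda ` PiE UNIV B. \<Prod>j\<in>UNIV. 1 / (k $ j + 1))"
    by (subst sum.reindex) (auto simp: inj_on_def)
  also have "\<dots> \<le> (\<Sum>k\<in>lattice_points W. \<Prod>j\<in>UNIV. 1 / (k $ j + 1))"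
  proof (rule sum_mono2[OF finite_lattice_points[OF assms(1)]])
    show "vec_lambda ` PiE UNIV B \<subseteq> lattice_points W"
      using assms(3) by (force simp: lattice_points_def B_def PiE_iff)
    show "0 \<le> (\<Prod>j\<in>UNIV. 1 / (k $ j + 1))" if "k \<in> lattice_points W - vec_lambda ` PiE UNIV B" for k
      using that assms(2) by (intro prod_nonneg) (force simp: lattice_points_def)
  qed
  finally show ?thesis .
qed

theorem theorem4p2:
  shows "\<exists>c>0. \<forall>(n :: real ^ 'd) (P :: (real ^ 'd) set).
           (\<forall>j. 1 \<le> n $ j) \<and> polyhedron P \<and> bounded P \<and>
           {x. \<forall>j. 0 \<le> x $ j \<and> x $ j \<le> n $ j} \<subseteq> P \<and> P \<subseteq> {x. \<forall>j. 0 \<le> x $ j} \<longrightarrow>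
           c * (\<Prod>j\<in>UNIV. ln (n $ j + 1)) \<le> lebesgue_constant P"
proof (intro exI[of _ "1 / pi ^ CARD('d)"] conjI allI impI)
  fix n :: "real ^ 'd" and P :: "(real ^ 'd) set"
  assume *: "(\<forall>j. 1 \<le> n $ j) \<and> polyhedron P \<and> bounded P \<and>
           {x. \<forall>j. 0 \<le> x $ j \<and> x $ j \<le> n $ j} \<subseteq> P \<and> P \<subseteq> {x. \<forall>j. 0 \<le> x $ j}"
  then have "0 \<le> n $ j" for j
    using order_trans[OF zero_le_one] by blast
  with * have "(\<Prod>j\<in>UNIV. ln (n $ j + 1)) \<le> (\<Sum>k\<in>lattice_points P. \<Prod>j\<in>UNIV. 1 / (k $ j + 1))"
    by (intro prod_ln_le_sum_lattice_points) auto
  also have "\<dots> \<le> pi ^ CARD('d) * lebesgue_constant P"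
    using * by (intro hardy_lebesgue_constant) auto
  finally show "1 / pi ^ CARD('d) * (\<Prod>j\<in>UNIV. ln (n $ j + 1)) \<le> lebesgue_constant P"
    by (simp add: field_simps)
qed simp

end
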